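(* Let $M\ge 2$, let $p>0$, let $q_1,\dots,q_M>0$ be not all equal, and set $q=\frac1M\sum_{i=1}^M q_i$. Let $f^{\rm het}(t)$ be the expected fraction of adopters in the complete network with $M$ nodes, external rates all equal to $p$, and internal rates $q_{i,j}=\frac{q_j}{M-1}$ for all $i\neq j$. Let $f^{\rm hom}(t)$ be the expected fraction of adopters in the homogeneous complete network with $M$ nodes, external rates all equal to $p$, and internal rates $q_{i,j}=\frac{q}{M-1}$ for all $i\ne j$. Then $$f^{\rm het}(t)<f^{\rm hom}(t),\qquad 0<t<\infty .$$
   Context: Discrete Bass model: a network has $M$ nodes, external rates $p_j\ge 0$ and internal rates $q_{i,j}\ge 0$ ($i\ne j$; the influence of $i$ on $j$). $X_j(t)\in\{0,1\}$ is the state of node $j$ ($1$ = adopter), $X_j(0)=0$ for all $j$. The process $(X_1,\dots,X_M)$ is a continuous-time Markov chain in which adopters remain adopters forever, and each nonadopter $j$ becomes an adopter at rate $p_j+\sum_{k\ne j}q_{k,j}X_k(t)$ (one node changes at a time). The expected fraction of adopters is $f(t)=\frac1M\,\mathbf{E}\big[\sum_{j=1}^M X_j(t)\big]$. The form $q_{i,j}=q_j/(M-1)$ is called mild heterogeneity in $q$. *)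

theory Defs
  imports "HOL-Probability.Probability"
begin

text \<open>Standard transition functions on a finite state space; \<open>Q\<close> is the generator (rate matrix),
  i.e. \<open>P h x y = P 0 x y + h * Q x y + o(h)\<close> as \<open>h\<close> decreases to 0.\<close>

definition transition_function :: "(real \<Rightarrow> 's::finite \<Rightarrow> 's \<Rightarrow> real) \<Rightarrow> bool" where
  "transition_function P \<longleftrightarrow>
     (\<forall>t\<ge>0. \<forall>x y. 0 \<le> P t x y) \<and>
     (\<forall>t\<ge>0. \<forall>x. (\<Sum>y\<in>UNIV. P t x y) = 1) \<and>
     (\<forall>x y. P 0 x y = of_bool (x = y)) \<and>
     (\<forall>s\<ge>0. \<forall>t\<ge>0. \<forall>x y. P (s + t) x y = (\<Sum>z\<in>UNIV. P s x z * P t z y))"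

definition has_generator :: "(real \<Rightarrow> 's \<Rightarrow> 's \<Rightarrow> real) \<Rightarrow> ('s \<Rightarrow> 's \<Rightarrow> real) \<Rightarrow> bool" where
  "has_generator P Q \<longleftrightarrow>
     (\<forall>x y. ((\<lambda>h. P h x y) has_real_derivative Q x y) (at_right 0))"

text \<open>Conditional probabilities are constrained only where the conditioning event has positive
  probability. No regularity of sample paths is required.\<close>

definition continuous_time_markov_chain ::
  "'w measure \<Rightarrow> (real \<Rightarrow> 'w \<Rightarrow> 's::finite) \<Rightarrow> ('s \<Rightarrow> 's \<Rightarrow> real) \<Rightarrow> bool" where
  "continuous_time_markov_chain \<Omega> X Q \<longleftrightarrow>
     prob_space \<Omega> \<and>
     (\<forall>t\<ge>0. X t \<in> \<Omega> \<rightarrow>\<^sub>M count_space UNIV) \<and>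
     (\<exists>P. transition_function P \<and> has_generator P Q \<and>
       (\<forall>(n::nat) (t::nat \<Rightarrow> real) s (x::nat \<Rightarrow> 's) y.
          0 \<le> t 0 \<longrightarrow> (\<forall>i<n. t i < t (Suc i)) \<longrightarrow> t n \<le> s \<longrightarrow>
          \<P>(\<omega> in \<Omega>. \<forall>i\<le>n. X (t i) \<omega> = x i) > 0 \<longrightarrow>
          \<P>(\<omega> in \<Omega>. X s \<omega> = y \<bar> \<forall>i\<le>n. X (t i) \<omega> = x i) = P (s - t n) (x n) y))"

text \<open>The nodes are the elements of the finite type \<open>'n\<close>, so the network has \<open>CARD('n)\<close> nodes.
  The state \<open>(X\<^sub>1, \<dots>, X\<^sub>M)\<close> is encoded as the set of adopters, that is,
  the node-wise state \<open>X\<^sub>j(t)\<close> is \<open>of_bool (j \<in> X t \<omega>)\<close>;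
  \<open>q k j\<close> is the influence of \<open>k\<close> on \<open>j\<close>, and the diagonal of \<open>q\<close> plays no role.\<close>

definition adoption_rate ::
  "('n::finite \<Rightarrow> real) \<Rightarrow> ('n \<Rightarrow> 'n \<Rightarrow> real) \<Rightarrow> 'n set \<Rightarrow> 'n \<Rightarrow> real" where
  "adoption_rate p q A j = p j + (\<Sum>k\<in>UNIV - {j}. q k j * of_bool (k \<in> A))"

definition bass_generator ::
  "('n::finite \<Rightarrow> real) \<Rightarrow> ('n \<Rightarrow> 'n \<Rightarrow> real) \<Rightarrow> 'n set \<Rightarrow> 'n set \<Rightarrow> real" where
  "bass_generator p q A B =
     (if B = A then - (\<Sum>j\<in>UNIV - A. adoption_rate p q A j)
      else (\<Sum>j\<in>UNIV - A. if B = insert j A then adoption_rate p q A j else 0))"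

definition discrete_bass_model ::
  "'w measure \<Rightarrow> (real \<Rightarrow> 'w \<Rightarrow> 'n::finite set) \<Rightarrow> ('n \<Rightarrow> real) \<Rightarrow> ('n \<Rightarrow> 'n \<Rightarrow> real) \<Rightarrow> bool" where
  "discrete_bass_model \<Omega> X p q \<longleftrightarrow>
     (\<forall>j. 0 \<le> p j) \<and> (\<forall>i j. i \<noteq> j \<longrightarrow> 0 \<le> q i j) \<and>
     continuous_time_markov_chain \<Omega> X (bass_generator p q) \<and>
     (AE \<omega> in \<Omega>. X 0 \<omega> = {})"

definition expected_adopter_fraction ::
  "'w measure \<Rightarrow> (real \<Rightarrow> 'w \<Rightarrow> 'n::finite set) \<Rightarrow> real \<Rightarrow> real" where
  "expected_adopter_fraction \<Omega> X t =
     1 / real CARD('n) * (\<integral>\<omega>. (\<Sum>j\<in>(UNIV :: 'n set). of_bool (j \<in> X t \<omega>)) \<partial>\<Omega>)"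

end

theory Submission
  imports Defs
begin

text \<open>Write \<open>u t A\<close> for the probability that \<open>A\<close> is the set of adopters at time \<open>t\<close>, and
  \<open>w j = q j / (M - 1)\<close> for the weight of node \<open>j\<close>. If \<open>w j \<le> w i\<close> then exchanging \<open>j\<close> for \<open>i\<close> in \<open>A\<close> does not decrease \<open>u t A\<close>: the forward equation for the difference
  has a nonnegative source term, by induction on \<open>card A\<close>. Hence, given \<open>k\<close> adopters, nodes with large
  weight are less likely to be still nonadopters, and by Chebyshev's sum inequality the mean jump rate
  from \<open>k\<close> to \<open>k + 1\<close> adopters is at most that of the homogeneous network, with strict inequality for
  \<open>k = 1\<close>. The differences \<open>E\<^sub>k\<close> of the tail probabilities of the number of adopters therefore satisfy
  \<open>E\<^sub>k\<^sub>+\<^sub>1' \<ge> c\<^sub>k (E\<^sub>k - E\<^sub>k\<^sub>+\<^sub>1)\<close>, which gives \<open>E\<^sub>k \<ge> 0\<close> by induction and \<open>E\<^sub>2 > 0\<close>; summing the tails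
  yields the means.\<close>

section \<open>The forward equation\<close>

lemma at_left_eq_filtermap_minus: "at_left (t::real) = filtermap (\<lambda>h. t - h) (at_right 0)"
proof -
  have "at_left t = filtermap uminus (filtermap (\<lambda>x. x + - t) (at_right 0))"
    by (simp only: at_left_minus[of t] at_right_to_0[of "- t"])
  then show ?thesis by (simp add: filtermap_filtermap)
qed

lemma transition_function_le_1:
  fixes P :: "real \<Rightarrow> 's::finite \<Rightarrow> 's \<Rightarrow> real"
  assumes "transition_function P" "0 \<le> t"
  shows "P t x y \<le> 1"
proof -
  have "P t x y \<le> (\<Sum>y\<in>UNIV. P t x y)"
    using assms by (intro member_le_sum) (auto simp: transition_function_def)
  then show ?thesis using assms by (simp add: transition_function_def)
qed

lemma generator_quotient_tendsto:
  assumes "has_generator P Q"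
  shows "((\<lambda>h. (P h z y - P 0 z y) / h) \<longlongrightarrow> Q z y) (at_right 0)"
  using assms by (simp add: has_generator_def has_field_derivative_iff)

lemma generator_diff_tendsto_0:
  assumes "has_generator P Q"
  shows "((\<lambda>h. P h z y - P 0 z y) \<longlongrightarrow> 0) (at_right 0)"
proof -
  have "((\<lambda>h. P h z y) has_real_derivative Q z y) (at_right 0)"
    using assms by (simp add: has_generator_def)
  then have "continuous (at_right 0) (\<lambda>h. P h z y)"
    by (rule DERIV_continuous)
  then show ?thesis
    by (simp add: continuous_within LIM_zero)
qed

text \<open>Subtract the Chapman-Kolmogorov identities for \<open>h\<close> and for 0. Increments at
  any time are thus reduced to increments at time 0, which the generator controls.\<close>

lemma transition_function_increment:
  fixes P :: "real \<Rightarrow> 's::finite \<Rightarrow> 's \<Rightarrow> real"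
  assumes P: "transition_function P" and "0 \<le> t" "0 \<le> h"
  shows "P (t + h) x y - P t x y = (\<Sum>z\<in>UNIV. P t x z * (P h z y - P 0 z y))"
proof -
  have *: "P (t + s) x y = (\<Sum>z\<in>UNIV. P t x z * P s z y)" if "0 \<le> s" for s
    using P that \<open>0 \<le> t\<close> by (simp add: transition_function_def)
  show ?thesis
    using *[of h] *[of 0] \<open>0 \<le> h\<close> by (simp add: right_diff_distrib sum_subtractf)
qed

text \<open>The increment formula started at \<open>t - h\<close> has coefficients in the unit
  interval, so the increment is bounded by a sum that does not depend on \<open>t\<close> and tends
  to 0 with \<open>h\<close>.\<close>

lemma transition_function_left_tendsto:
  fixes P :: "real \<Rightarrow> 's::finite \<Rightarrow> 's \<Rightarrow> real"
  assumes P: "transition_function P" and Q: "has_generator P Q" and "0 < t"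
  shows "((\<lambda>h. P (t - h) x y) \<longlongrightarrow> P t x y) (at_right 0)"
proof -
  have ev: "\<forall>\<^sub>F h in at_right 0. 0 < h \<and> h < t"
    using eventually_at_right_real[OF \<open>0 < t\<close>] by simp
  have "((\<lambda>h. P (t - h) x y - P t x y) \<longlongrightarrow> 0) (at_right 0)"
  proof (rule Lim_null_comparison)
    show "\<forall>\<^sub>F h in at_right 0. norm (P (t - h) x y - P t x y) \<le> (\<Sum>z\<in>UNIV. \<bar>P h z y - P 0 z y\<bar>)"
      using ev
    proof eventually_elim
      case (elim h)
      have "\<bar>P t x y - P (t - h) x y\<bar> = \<bar>\<Sum>z\<in>UNIV. P (t - h) x z * (P h z y - P 0 z y)\<bar>"
        using transition_function_increment[OF P, of "t - h" h x y] elim by simp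
      also have "\<dots> \<le> (\<Sum>z\<in>UNIV. \<bar>P (t - h) x z * (P h z y - P 0 z y)\<bar>)"
        by (rule sum_abs)
      also have "\<dots> \<le> (\<Sum>z\<in>UNIV. \<bar>P h z y - P 0 z y\<bar>)"
      proof (rule sum_mono)
        fix z
        have "0 \<le> P (t - h) x z" "P (t - h) x z \<le> 1"
          using P transition_function_le_1[OF P, of "t - h"] elim
          by (auto simp: transition_function_def)
        then show "\<bar>P (t - h) x z * (P h z y - P 0 z y)\<bar> \<le> \<bar>P h z y - P 0 z y\<bar>"
          by (simp add: abs_mult mult_left_le_one_le)
      qed
      finally show ?case by (simp add: abs_minus_commute)
    qed
    show "((\<lambda>h. \<Sum>z\<in>UNIV. \<bar>P h z y - P 0 z y\<bar>) \<longlongrightarrow> 0) (at_right 0)"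
      by (intro tendsto_null_sum tendsto_rabs_zero generator_diff_tendsto_0[OF Q])
  qed
  then show ?thesis by (rule LIM_zero_cancel)
qed

text \<open>The generator is only a right derivative at 0. The right quotient at \<open>t\<close>
  uses the increment started at \<open>t\<close>; the left quotient uses the one started at
  \<open>t - h\<close>, whose coefficients converge by left continuity.\<close>

lemma kolmogorov_forward:
  fixes P :: "real \<Rightarrow> 's::finite \<Rightarrow> 's \<Rightarrow> real"
  assumes P: "transition_function P" and Q: "has_generator P Q" and "0 < t"
  shows "((\<lambda>s. P s x y) has_real_derivative (\<Sum>z\<in>UNIV. P t x z * Q z y)) (at t)"
proof -
  have ev: "\<forall>\<^sub>F h in at_right 0. 0 < h \<and> h < t"
    using eventually_at_right_real[OF \<open>0 < t\<close>] by simp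
  have "((\<lambda>h. \<Sum>z\<in>UNIV. P t x z * ((P h z y - P 0 z y) / h)) \<longlongrightarrow> (\<Sum>z\<in>UNIV. P t x z * Q z y)) (at_right 0)"
    by (intro tendsto_intros generator_quotient_tendsto[OF Q])
  moreover have "\<forall>\<^sub>F h in at_right 0. (\<Sum>z\<in>UNIV. P t x z * ((P h z y - P 0 z y) / h)) = (P (h + t) x y - P t x y) / (h + t - t)"
    using ev
  proof eventually_elim
    case (elim h)
    then show ?case
      using transition_function_increment[OF P, of t h x y] by (simp add: add.commute sum_divide_distrib)
  qed
  ultimately have right: "((\<lambda>s. (P s x y - P t x y) / (s - t)) \<longlongrightarrow> (\<Sum>z\<in>UNIV. P t x z * Q z y)) (at_right t)"
    unfolding at_right_to_0[of t] filterlim_filtermap by (rule Lim_transform_eventually)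
  have "((\<lambda>h. \<Sum>z\<in>UNIV. P (t - h) x z * ((P h z y - P 0 z y) / h)) \<longlongrightarrow> (\<Sum>z\<in>UNIV. P t x z * Q z y)) (at_right 0)"
    by (intro tendsto_intros generator_quotient_tendsto[OF Q] transition_function_left_tendsto[OF P Q \<open>0 < t\<close>])
  moreover have "\<forall>\<^sub>F h in at_right 0. (\<Sum>z\<in>UNIV. P (t - h) x z * ((P h z y - P 0 z y) / h)) = (P (t - h) x y - P t x y) / (t - h - t)"
    using ev
  proof eventually_elim
    case (elim h)
    then show ?case
      using transition_function_increment[OF P, of "t - h" h x y]
      by (simp add: sum_divide_distrib[symmetric] field_simps)
  qed
  ultimately have "((\<lambda>s. (P s x y - P t x y) / (s - t)) \<longlongrightarrow> (\<Sum>z\<in>UNIV. P t x z * Q z y)) (at_left t)"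
    unfolding at_left_eq_filtermap_minus[of t] filterlim_filtermap by (rule Lim_transform_eventually)
  then show ?thesis
    using right
    by (simp add: has_field_derivative_iff filterlim_at_split)
qed

lemma transition_function_continuous_on:
  fixes P :: "real \<Rightarrow> 's::finite \<Rightarrow> 's \<Rightarrow> real"
  assumes P: "transition_function P" and Q: "has_generator P Q"
  shows "continuous_on {0..} (\<lambda>t. P t x y)"
  unfolding continuous_on_eq_continuous_within
proof
  fix t :: real assume "t \<in> {0..}"
  then consider "t = 0" | "0 < t" by force
  then show "continuous (at t within {0..}) (\<lambda>t. P t x y)"
  proof cases
    case 1
    then show ?thesis
      using LIM_zero_cancel[OF generator_diff_tendsto_0[OF Q]]
      by (simp add: continuous_within at_within_Ici_at_right)
  next
    case 2
    then show ?thesis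
      using DERIV_isCont[OF kolmogorov_forward[OF P Q]] continuous_at_imp_continuous_at_within by blast
  qed
qed

section \<open>Gronwall and Chebyshev inequalities\<close>

text \<open>Integrating factor: \<open>exp (c * s) * f s\<close> has derivative
  \<open>exp (c * s) * (c * f s + f' s)\<close>. Derivatives are required only at positive times,
  where the forward equation is available.\<close>

lemma exp_weighted_increasing:
  fixes f f' :: "real \<Rightarrow> real"
  assumes f: "continuous_on {0..} f" "\<And>s. 0 < s \<Longrightarrow> (f has_real_derivative f' s) (at s)"
  shows "0 \<le> t \<Longrightarrow> (\<And>s. 0 < s \<Longrightarrow> - c * f s \<le> f' s) \<Longrightarrow> f 0 \<le> exp (c * t) * f t"
    and "0 < t \<Longrightarrow> (\<And>s. 0 < s \<Longrightarrow> - c * f s < f' s) \<Longrightarrow> f 0 < exp (c * t) * f t"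
proof -
  let ?g = "\<lambda>s. exp (c * s) * f s"
  have deriv: "(?g has_real_derivative exp (c * s) * (c * f s + f' s)) (at s)" if "0 < s" for s
    by (auto intro!: derivative_eq_intros f(2) that simp: algebra_simps)
  have cont: "continuous_on {0..t} ?g"
    by (intro continuous_intros continuous_on_subset[OF f(1)]) auto
  show "f 0 \<le> exp (c * t) * f t" if "0 \<le> t" "\<And>s. 0 < s \<Longrightarrow> - c * f s \<le> f' s"
  proof -
    have "0 \<le> exp (c * s) * (c * f s + f' s)" if "0 < s" for s
      using \<open>\<And>s. 0 < s \<Longrightarrow> - c * f s \<le> f' s\<close>[OF that] by simp
    then have "?g 0 \<le> ?g t"
      using deriv by (intro DERIV_nonneg_imp_increasing_open[OF \<open>0 \<le> t\<close> _ cont]) blast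
    then show ?thesis by simp
  qed
  show "f 0 < exp (c * t) * f t" if "0 < t" "\<And>s. 0 < s \<Longrightarrow> - c * f s < f' s"
  proof -
    have "0 < exp (c * s) * (c * f s + f' s)" if "0 < s" for s
      using \<open>\<And>s. 0 < s \<Longrightarrow> - c * f s < f' s\<close>[OF that] by simp
    then have "?g 0 < ?g t"
      using deriv by (intro DERIV_pos_imp_increasing_open[OF \<open>0 < t\<close> _ cont]) blast
    then show ?thesis by simp
  qed
qed

text \<open>The products \<open>(a j - a i) * (b i - b j)\<close> are all nonnegative, and their sum
  over all pairs is twice the gap between the two sides. One positive product makes the gap
  strict.\<close>

lemma chebyshev_sum_antitone:
  fixes a b :: "'n::finite \<Rightarrow> real"
  assumes anti: "\<And>i j. a i \<le> a j \<Longrightarrow> b j \<le> b i"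
  shows "real CARD('n) * (\<Sum>i\<in>UNIV. a i * b i) \<le> (\<Sum>i\<in>UNIV. a i) * (\<Sum>i\<in>UNIV. b i)"
    and "a i < a j \<Longrightarrow> b j < b i \<Longrightarrow>
      real CARD('n) * (\<Sum>i\<in>UNIV. a i * b i) < (\<Sum>i\<in>UNIV. a i) * (\<Sum>i\<in>UNIV. b i)"
proof -
  let ?d = "\<lambda>i j. (a j - a i) * (b i - b j)"
  have nonneg: "0 \<le> ?d i j" for i j
    using anti[of i j] anti[of j i] by (cases "a i \<le> a j") (auto simp: mult_nonpos_nonpos)
  have eq: "(\<Sum>i\<in>UNIV. \<Sum>j\<in>UNIV. ?d i j) =
      2 * ((\<Sum>i\<in>UNIV. a i) * (\<Sum>i\<in>UNIV. b i) - real CARD('n) * (\<Sum>i\<in>UNIV. a i * b i))"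
  proof -
    have "(\<Sum>i\<in>UNIV. \<Sum>j\<in>UNIV. ?d i j) =
      (\<Sum>i\<in>UNIV. \<Sum>j\<in>UNIV. a j * b i) + (\<Sum>i\<in>UNIV. \<Sum>j\<in>UNIV. a i * b j)
      - (\<Sum>i\<in>UNIV. \<Sum>j\<in>(UNIV::'n set). a i * b i) - (\<Sum>i\<in>(UNIV::'n set). \<Sum>j\<in>UNIV. a j * b j)"
    proof -
      have "?d i j = a j * b i + a i * b j - a i * b i - a j * b j" for i j
        by (simp add: algebra_simps)
      then show ?thesis by (simp only: sum.distrib sum_subtractf)
    qed
    also have "(\<Sum>i\<in>UNIV. \<Sum>j\<in>UNIV. a j * b i) = (\<Sum>i\<in>UNIV. a i) * (\<Sum>i\<in>UNIV. b i)"
      by (simp add: sum_product) (rule sum.swap)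
    also have "(\<Sum>i\<in>UNIV. \<Sum>j\<in>UNIV. a i * b j) = (\<Sum>i\<in>UNIV. a i) * (\<Sum>i\<in>UNIV. b i)"
      by (simp add: sum_product)
    finally show ?thesis by (simp add: sum_distrib_left[symmetric])
  qed
  have "0 \<le> (\<Sum>i\<in>UNIV. \<Sum>j\<in>UNIV. ?d i j)"
    by (intro sum_nonneg nonneg)
  then show "real CARD('n) * (\<Sum>i\<in>UNIV. a i * b i) \<le> (\<Sum>i\<in>UNIV. a i) * (\<Sum>i\<in>UNIV. b i)"
    unfolding eq by simp
  show "real CARD('n) * (\<Sum>i\<in>UNIV. a i * b i) < (\<Sum>i\<in>UNIV. a i) * (\<Sum>i\<in>UNIV. b i)"
    if "a i < a j" "b j < b i"
  proof -
    have "0 < (\<Sum>j\<in>UNIV. ?d i j)"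
      using that by (intro sum_pos2[of _ j] nonneg) auto
    then have "0 < (\<Sum>i\<in>UNIV. \<Sum>j\<in>UNIV. ?d i j)"
      by (rule sum_pos2[OF finite UNIV_I]) (intro sum_nonneg nonneg)
    then show ?thesis unfolding eq by simp
  qed
qed

section \<open>Mean-field adoption\<close>

text \<open>What is kept of a chain is its law from the empty state and the forward equation in weak
  form. Choosing the test function \<open>g\<close> yields equations for single states and for
  tails; constant \<open>w\<close> is the homogeneous network.\<close>

locale mean_field_law =
  fixes p :: real and w :: "'n::finite \<Rightarrow> real" and u :: "real \<Rightarrow> 'n set \<Rightarrow> real"
  assumes p_pos: "0 < p"
    and w_nonneg: "0 \<le> w j"
    and nonneg: "0 \<le> t \<Longrightarrow> 0 \<le> u t A"
    and sum_1: "0 \<le> t \<Longrightarrow> (\<Sum>A\<in>UNIV. u t A) = 1"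
    and init: "u 0 A = of_bool (A = {})"
    and cont: "continuous_on {0..} (\<lambda>t. u t A)"
    and forward: "0 < t \<Longrightarrow> ((\<lambda>t. \<Sum>A\<in>UNIV. u t A * g A) has_real_derivative
      (\<Sum>A\<in>UNIV. u t A * (\<Sum>j\<in>- A. (p + w j * card A) * (g (insert j A) - g A)))) (at t)"
begin

lemma rate_pos: "0 < p + w j * real n"
  using p_pos w_nonneg[of j] by (simp add: add_pos_nonneg)

text \<open>This is \<open>forward\<close> tested with the indicator of \<open>B\<close>: inflow
  from the states lacking one node of \<open>B\<close>, outflow at the total rate of the
  nonadopters.\<close>

lemma master_equation:
  assumes "0 < t"
  shows "((\<lambda>t. u t B) has_real_derivative
    (\<Sum>l\<in>B. (p + w l * card (B - {l})) * u t (B - {l})) - (\<Sum>j\<in>- B. p + w j * card B) * u t B) (at t)"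
proof -
  let ?r = "\<lambda>A j. p + w j * card A"
  \<comment> \<open>Reindexes the inflow: the source state is determined by the node of
    \<open>B\<close> that adopts last.\<close>
  have iff: "j \<notin> A \<and> insert j A = B \<longleftrightarrow> j \<in> B \<and> A = B - {j}" for j A
    by auto
  have "(\<Sum>A\<in>UNIV. \<Sum>j\<in>- A. u t A * ?r A j * of_bool (insert j A = B))
    = (\<Sum>A\<in>UNIV. \<Sum>j\<in>UNIV. u t A * ?r A j * of_bool (j \<notin> A \<and> insert j A = B))"
    by (intro sum.cong sum.mono_neutral_cong_left) auto
  also have "\<dots> = (\<Sum>j\<in>UNIV. \<Sum>A\<in>UNIV. u t A * ?r A j * of_bool (j \<in> B \<and> A = B - {j}))"
    unfolding iff by (rule sum.swap)
  also have "\<dots> = (\<Sum>j\<in>UNIV. \<Sum>A\<in>UNIV. if A = B - {j} then u t A * ?r A j * of_bool (j \<in> B) else 0)"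
    by (intro sum.cong) auto
  also have "\<dots> = (\<Sum>l\<in>B. ?r (B - {l}) l * u t (B - {l}))"
    unfolding sum.delta[OF finite] by (simp add: mult.commute del: of_bool_eq_iff)
  finally have gain: "(\<Sum>A\<in>UNIV. \<Sum>j\<in>- A. u t A * ?r A j * of_bool (insert j A = B)) = (\<Sum>l\<in>B. ?r (B - {l}) l * u t (B - {l}))" .
  have "(\<Sum>A\<in>UNIV. \<Sum>j\<in>- A. u t A * ?r A j * of_bool (A = B)) =
    (\<Sum>A\<in>UNIV. if A = B then (\<Sum>j\<in>- A. ?r A j) * u t A else 0)"
    by (intro sum.cong) (auto simp: sum_distrib_left mult.commute)
  then have loss: "(\<Sum>A\<in>UNIV. \<Sum>j\<in>- A. u t A * ?r A j * of_bool (A = B)) = (\<Sum>j\<in>- B. ?r B j) * u t B"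
    by simp
  have "(\<Sum>A\<in>UNIV. u t A * (\<Sum>j\<in>- A. ?r A j * (of_bool (insert j A = B) - of_bool (A = B)))) =
    (\<Sum>A\<in>UNIV. \<Sum>j\<in>- A. u t A * ?r A j * of_bool (insert j A = B)) -
    (\<Sum>A\<in>UNIV. \<Sum>j\<in>- A. u t A * ?r A j * of_bool (A = B))"
    unfolding sum_subtractf[symmetric] sum_distrib_left
    by (intro sum.cong refl) (simp only: right_diff_distrib mult.assoc)
  also note gain
  also note loss
  finally show ?thesis
    using forward[OF assms, of "\<lambda>A. of_bool (A = B)"] by simp
qed

text \<open>Induction on \<open>card B\<close>. The integrating factor absorbs the outflow; the
  empty state starts with mass 1, and any other state has positive inflow from smaller states
  because \<open>p\<close> is positive.\<close>

lemma positive: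
  assumes "0 < t"
  shows "0 < u t B"
  using assms
proof (induction "card B" arbitrary: B t rule: less_induct)
  case less
  let ?c = "\<Sum>j\<in>- B. p + w j * card B"
  show ?case
  proof (cases "B = {}")
    case True
    have "u 0 B \<le> exp (?c * t) * u t B"
      by (rule exp_weighted_increasing(1)[OF cont master_equation]) (use less True in auto)
    then have "0 < exp (?c * t) * u t B" using True by (simp add: init)
    then show ?thesis by (simp add: zero_less_mult_iff)
  next
    case False
    have "u 0 B < exp (?c * t) * u t B"
    proof (rule exp_weighted_increasing(2)[OF cont master_equation])
      fix s :: real assume "0 < s"
      have "0 < (p + w l * card (B - {l})) * u s (B - {l})" if "l \<in> B" for l
        using less.hyps[OF _ \<open>0 < s\<close>, of "B - {l}"] that
        by (intro mult_pos_pos rate_pos) (simp add: card_gt_0_iff False)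
      then have "0 < (\<Sum>l\<in>B. (p + w l * card (B - {l})) * u s (B - {l}))"
        using False by (intro sum_pos) auto
      then show "- ?c * u s B < (\<Sum>l\<in>B. (p + w l * card (B - {l})) * u s (B - {l})) - ?c * u s B"
        by simp
    qed (use less in auto)
    then have "0 < exp (?c * t) * u t B" using False by (simp add: init)
    then show ?thesis by (simp add: zero_less_mult_iff)
  qed
qed

section \<open>Comparison of states under exchange of adopters\<close>

text \<open>Subtract two master equations. The inflow from \<open>B\<close> contributes
  \<open>w i - w j\<close>, the other inflows are differences of the same kind for smaller sets, and
  the two outflow rates differ by \<open>(w i - w j) * (card B + 1)\<close>.\<close>

lemma swap_difference_deriv:
  assumes "i \<notin> B" "j \<notin> B" "i \<noteq> j" "0 < t"
  shows "((\<lambda>t. u t (insert i B) - u t (insert j B)) has_real_derivative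
    (w i - w j) * (card B * u t B + (card B + 1) * u t (insert j B))
    + (\<Sum>l\<in>B. (p + w l * card B) * (u t (insert i (B - {l})) - u t (insert j (B - {l}))))
    - (\<Sum>k\<in>- insert i B. p + w k * (card B + 1)) * (u t (insert i B) - u t (insert j B))) (at t)"
proof -
  have gain: "(\<Sum>l\<in>insert i B. (p + w l * card (insert i B - {l})) * u t (insert i B - {l})) =
    (p + w i * card B) * u t B + (\<Sum>l\<in>B. (p + w l * card B) * u t (insert i (B - {l})))"
    if "i \<notin> B" for i
  proof -
    have "card (insert i B - {l}) = card B" "insert i B - {l} = insert i (B - {l})" if "l \<in> B" for l
      using that \<open>i \<notin> B\<close> by (auto simp: card_Diff_singleton)
    then show ?thesis using that by (simp add: sum.insert)
  qed
  \<comment> \<open>Isolates the nonadopters common to both states, so that the two outflow rates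
    differ in one summand.\<close>
  have loss: "(\<Sum>k\<in>- insert i B. p + w k * card (insert i B)) =
     (\<Sum>k\<in>- insert i (insert j B). p + w k * (card B + 1)) + (p + w j * (card B + 1))"
    if "i \<notin> B" "j \<notin> B" "i \<noteq> j" for i j
  proof -
    have "- insert i B = insert j (- insert i (insert j B))" using that by auto
    then show ?thesis using that by (simp add: sum.insert add.commute)
  qed
  have comm: "insert j (insert i B) = insert i (insert j B)" by auto
  show ?thesis
    using DERIV_diff[OF master_equation[OF \<open>0 < t\<close>, of "insert i B"] master_equation[OF \<open>0 < t\<close>, of "insert j B"]]
    unfolding gain[OF assms(1)] gain[OF assms(2)] loss[OF assms(1-3)] loss[OF assms(2,1) assms(3)[symmetric]]
    using loss[OF assms(1-3)] assms(1)
    by (elim DERIV_cong) (simp add: comm right_diff_distrib sum_subtractf algebra_simps)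
qed

text \<open>Induction on \<open>card B\<close> makes every source term in
  \<open>swap_difference_deriv\<close> nonnegative, and the difference starts at 0 since both states
  are nonempty.\<close>

lemma swap_mono:
  assumes "i \<notin> B" "j \<notin> B" "i \<noteq> j" "w j \<le> w i" "0 \<le> t"
  shows "u t (insert j B) \<le> u t (insert i B)"
  using assms
proof (induction "card B" arbitrary: B t rule: less_induct)
  case less
  let ?c = "\<Sum>k\<in>- insert i B. p + w k * (card B + 1)"
  have "u 0 (insert i B) - u 0 (insert j B) \<le> exp (?c * t) * (u t (insert i B) - u t (insert j B))"
  proof (rule exp_weighted_increasing(1)[OF _ swap_difference_deriv[OF less.prems(1-3)]])
    fix s :: real assume "0 < s"
    have "0 \<le> (p + w l * card B) * (u s (insert i (B - {l})) - u s (insert j (B - {l})))" if "l \<in> B" for l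
      using less.hyps[OF card_Diff1_less[OF finite that], of s] less.prems \<open>0 < s\<close> rate_pos[of l "card B"]
      by (intro mult_nonneg_nonneg) auto
    then have "0 \<le> (\<Sum>l\<in>B. (p + w l * card B) * (u s (insert i (B - {l})) - u s (insert j (B - {l}))))"
      by (rule sum_nonneg)
    moreover have "0 \<le> (w i - w j) * (card B * u s B + (card B + 1) * u s (insert j B))"
      using less.prems \<open>0 < s\<close> by (intro mult_nonneg_nonneg add_nonneg_nonneg nonneg) auto
    ultimately show "- ?c * (u s (insert i B) - u s (insert j B)) \<le>
      (w i - w j) * (card B * u s B + (card B + 1) * u s (insert j B))
      + (\<Sum>l\<in>B. (p + w l * card B) * (u s (insert i (B - {l})) - u s (insert j (B - {l}))))
      - ?c * (u s (insert i B) - u s (insert j B))"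
      by simp
  qed (use less.prems in \<open>auto intro: continuous_intros cont\<close>)
  then have "0 \<le> exp (?c * t) * (u t (insert i B) - u t (insert j B))"
    by (simp add: init)
  then show ?case by (simp add: zero_le_mult_iff)
qed

text \<open>The smaller sets need only the weak inequality \<open>swap_mono\<close>. Strictness
  comes from the source term with \<open>u t (insert j B)\<close>, positive even when
  \<open>B\<close> is empty.\<close>

lemma swap_strict_mono:
  assumes "i \<notin> B" "j \<notin> B" "w j < w i" "0 < t"
  shows "u t (insert j B) < u t (insert i B)"
proof -
  let ?c = "\<Sum>k\<in>- insert i B. p + w k * (card B + 1)"
  have "i \<noteq> j" using assms by auto
  have "u 0 (insert i B) - u 0 (insert j B) < exp (?c * t) * (u t (insert i B) - u t (insert j B))"
  proof (rule exp_weighted_increasing(2)[OF _ swap_difference_deriv[OF assms(1,2) \<open>i \<noteq> j\<close>]])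
    fix s :: real assume "0 < s"
    have "0 \<le> (p + w l * card B) * (u s (insert i (B - {l})) - u s (insert j (B - {l})))" if "l \<in> B" for l
      using swap_mono[of i "B - {l}" j s] assms that \<open>0 < s\<close> rate_pos[of l "card B"]
      by (intro mult_nonneg_nonneg) auto
    then have "0 \<le> (\<Sum>l\<in>B. (p + w l * card B) * (u s (insert i (B - {l})) - u s (insert j (B - {l}))))"
      by (rule sum_nonneg)
    moreover have "0 < (w i - w j) * (card B * u s B + (card B + 1) * u s (insert j B))"
      using assms \<open>0 < s\<close>
      by (intro mult_pos_pos add_nonneg_pos positive mult_nonneg_nonneg nonneg) auto
    ultimately show "- ?c * (u s (insert i B) - u s (insert j B)) <
      (w i - w j) * (card B * u s B + (card B + 1) * u s (insert j B))
      + (\<Sum>l\<in>B. (p + w l * card B) * (u s (insert i (B - {l})) - u s (insert j (B - {l}))))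
      - ?c * (u s (insert i B) - u s (insert j B))"
      by simp
  qed (use assms in \<open>auto intro: continuous_intros cont\<close>)
  then have "0 < exp (?c * t) * (u t (insert i B) - u t (insert j B))"
    by (simp add: init)
  then show ?thesis by (simp add: zero_less_mult_iff)
qed

section \<open>Tail probabilities and flux between adoption levels\<close>

text \<open>Survival function of the number of adopters. Tails are preferred to level probabilities
  because each changes through a single flux and their sum is the mean.\<close>

definition tail :: "nat \<Rightarrow> real \<Rightarrow> real" where
  "tail k t = (\<Sum>A\<in>UNIV. u t A * of_bool (k \<le> card A))"

text \<open>Probability flow per unit time from \<open>k\<close> to \<open>k + 1\<close>
  adopters.\<close>

definition flux :: "nat \<Rightarrow> real \<Rightarrow> real" where
  "flux k t = (\<Sum>A | card A = k. u t A * (\<Sum>j\<in>- A. p + w j * k))"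

lemma tail_0: "0 \<le> t \<Longrightarrow> tail 0 t = 1"
  by (simp add: tail_def sum_1)

lemma tail_Suc_init: "tail (Suc k) 0 = 0"
  by (auto simp: tail_def init intro!: sum.neutral)

lemma tail_continuous: "continuous_on {0..} (tail k)"
  unfolding tail_def by (intro continuous_intros cont)

lemma tail_diff: "tail k t - tail (Suc k) t = (\<Sum>A | card A = k. u t A)"
proof -
  have "tail k t - tail (Suc k) t = (\<Sum>A\<in>UNIV. if card A = k then u t A else 0)"
    unfolding tail_def sum_subtractf[symmetric] by (intro sum.cong) auto
  then show ?thesis by (simp add: sum.If_cases)
qed

text \<open>Layer-cake formula: \<open>card A\<close> counts the \<open>k\<close> from 1 up to
  it.\<close>

lemma mean_card: "(\<Sum>A\<in>UNIV. u t A * card A) = (\<Sum>k\<in>{1..CARD('n)}. tail k t)"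
proof -
  have "real (card A) = (\<Sum>k\<in>{1..CARD('n)}. of_bool (k \<le> card A))" for A :: "'n set"
  proof -
    have "{1..CARD('n)} \<inter> {k. k \<le> card A} = {1..card A}"
      using card_mono[of UNIV A] by auto
    then show ?thesis by (simp add: sum_of_bool_eq)
  qed
  then have "(\<Sum>A\<in>UNIV. u t A * card A) = (\<Sum>A\<in>UNIV. \<Sum>k\<in>{1..CARD('n)}. u t A * of_bool (k \<le> card A))"
    by (simp only: sum_distrib_left)
  also have "\<dots> = (\<Sum>k\<in>{1..CARD('n)}. tail k t)"
    unfolding tail_def by (rule sum.swap)
  finally show ?thesis .
qed

text \<open>Test \<open>forward\<close> with the indicator of more than \<open>k\<close> adopters:
  one adoption changes it exactly when there were \<open>k\<close>.\<close>

lemma tail_Suc_deriv: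
  assumes "0 < t"
  shows "(tail (Suc k) has_real_derivative flux k t) (at t)"
proof -
  let ?g = "\<lambda>A :: 'n set. of_bool (Suc k \<le> card A) :: real"
  have "u t A * (\<Sum>j\<in>- A. (p + w j * card A) * (?g (insert j A) - ?g A)) =
    (if card A = k then u t A * (\<Sum>j\<in>- A. p + w j * k) else 0)" for A
  proof -
    have "?g (insert j A) - ?g A = of_bool (card A = k)" if "j \<in> - A" for j
      using that by auto
    then have "(\<Sum>j\<in>- A. (p + w j * card A) * (?g (insert j A) - ?g A)) =
      (\<Sum>j\<in>- A. (p + w j * card A) * of_bool (card A = k))"
      by (intro sum.cong) auto
    then show ?thesis by simp
  qed
  then have "(\<Sum>A\<in>UNIV. u t A * (\<Sum>j\<in>- A. (p + w j * card A) * (?g (insert j A) - ?g A))) = flux k t"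
    by (simp add: flux_def sum.If_cases)
  then show ?thesis
    using forward[OF assms, of ?g] by (simp add: tail_def[abs_def])
qed

text \<open>Split the sets avoiding one node by whether they contain the other. Those avoiding both
  cancel; the rest are matched by exchanging \<open>j\<close> for \<open>i\<close> and compared by
  \<open>swap_mono\<close>. In the strict part, \<open>A\<close> witnesses that a matched pair
  exists.\<close>

lemma level_without_antimono:
  assumes "w j \<le> w i" "0 \<le> t"
  shows "(\<Sum>A | card A = k \<and> i \<notin> A. u t A) \<le> (\<Sum>A | card A = k \<and> j \<notin> A. u t A)"
    and "w j < w i \<Longrightarrow> 0 < t \<Longrightarrow> card A = k \<Longrightarrow> j \<in> A \<Longrightarrow> i \<notin> A \<Longrightarrow>
      (\<Sum>A | card A = k \<and> i \<notin> A. u t A) < (\<Sum>A | card A = k \<and> j \<notin> A. u t A)"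
proof -
  let ?S = "\<lambda>i j. {A. card A = k \<and> i \<notin> A \<and> j \<in> A}"
  let ?N = "{A. card A = k \<and> i \<notin> A \<and> j \<notin> A}"
  have split: "(\<Sum>A | card A = k \<and> i \<notin> A. u t A) = (\<Sum>A\<in>{A. card A = k \<and> i \<notin> A \<and> j \<notin> A}. u t A) + (\<Sum>A\<in>?S i j. u t A)" for i j
    by (subst sum.union_disjoint[symmetric]) (auto intro!: sum.cong)
  have comm: "{A. card A = k \<and> j \<notin> A \<and> i \<notin> A} = ?N"
    by auto
  have exchange: "(\<Sum>A\<in>?S j i. u t A) = (\<Sum>A\<in>?S i j. u t (insert i (A - {j})))"
  proof (rule sum.reindex_bij_witness[of _ "\<lambda>A. insert i (A - {j})" "\<lambda>A. insert j (A - {i})"])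
    have "card (insert i (A - {j})) = card A" if "i \<notin> A" "j \<in> A" for A and i j :: 'n
      using card_Suc_Diff1[of A j] that by (simp del: card_Diff_insert)
    then show "A \<in> ?S j i \<Longrightarrow> insert j (A - {i}) \<in> ?S i j"
      and "A \<in> ?S i j \<Longrightarrow> insert i (A - {j}) \<in> ?S j i" for A
      by auto
  qed (auto intro: arg_cong[of _ _ "u t"])
  have le: "u t A \<le> u t (insert i (A - {j}))" if "A \<in> ?S i j" for A
    using swap_mono[of i "A - {j}" j t] that assms by (auto simp: insert_absorb)
  show "(\<Sum>A | card A = k \<and> i \<notin> A. u t A) \<le> (\<Sum>A | card A = k \<and> j \<notin> A. u t A)"
    unfolding split[of i j] split[of j i] comm exchange
    by (intro add_left_mono sum_mono le)
  show "(\<Sum>A | card A = k \<and> i \<notin> A. u t A) < (\<Sum>A | card A = k \<and> j \<notin> A. u t A)"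
    if "w j < w i" "0 < t" "card A = k" "j \<in> A" "i \<notin> A"
  proof -
    have "u t A < u t (insert i (A - {j}))"
      using swap_strict_mono[of i "A - {j}" j t] that by (auto simp: insert_absorb)
    then have "(\<Sum>A\<in>?S i j. u t A) < (\<Sum>A\<in>?S i j. u t (insert i (A - {j})))"
      using that by (intro sum_strict_mono_ex1) (auto intro!: le)
    then show ?thesis
      unfolding split[of i j] split[of j i] comm exchange by simp
  qed
qed

text \<open>Exchanging sums isolates the only dependence on the weights, a sum of products over
  nodes to which Chebyshev's inequality applies.\<close>

lemma flux_eq:
  "flux k t = p * (real CARD('n) - k) * (\<Sum>A | card A = k. u t A)
     + k * (\<Sum>j\<in>UNIV. w j * (\<Sum>A | card A = k \<and> j \<notin> A. u t A))"
proof -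
  have swap: "(\<Sum>j\<in>UNIV. w j * (\<Sum>A | card A = k \<and> j \<notin> A. u t A)) = (\<Sum>A | card A = k. u t A * (\<Sum>j\<in>- A. w j))"
  proof -
    have "(\<Sum>j\<in>UNIV. w j * (\<Sum>A | card A = k \<and> j \<notin> A. u t A)) =
      (\<Sum>j\<in>UNIV. \<Sum>A | A \<in> {A. card A = k} \<and> j \<notin> A. u t A * w j)"
      by (simp add: sum_distrib_left mult.commute)
    also have "\<dots> = (\<Sum>A\<in>{A. card A = k}. \<Sum>j | j \<in> UNIV \<and> j \<notin> A. u t A * w j)"
      by (rule sum.swap_restrict) auto
    finally show ?thesis by (simp add: sum_distrib_left Compl_eq)
  qed
  have "(\<Sum>j\<in>- A. p + w j * k) = p * (real CARD('n) - k) + k * (\<Sum>j\<in>- A. w j)" if "card A = k" for A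
  proof -
    have "real (card (- A)) = real CARD('n) - k"
      using card_mono[of UNIV A] that by (simp add: Compl_eq_Diff_UNIV card_Diff_subset of_nat_diff)
    then show ?thesis by (simp add: sum.distrib sum_distrib_left mult.commute)
  qed
  then have "flux k t = (\<Sum>A | card A = k. u t A * (p * (real CARD('n) - k) + k * (\<Sum>j\<in>- A. w j)))"
    unfolding flux_def by (intro sum.cong) auto
  then show ?thesis
    unfolding swap by (simp add: sum_distrib_left sum.distrib distrib_left mult_ac)
qed

text \<open>Double counting: a set with \<open>k\<close> elements is avoided by
  \<open>CARD('n) - k\<close> nodes.\<close>

lemma sum_level_without:
  "(\<Sum>j\<in>UNIV. \<Sum>A | card A = k \<and> j \<notin> A. u t A) = (real CARD('n) - k) * (\<Sum>A | card A = k. u t A)"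
proof -
  have "(\<Sum>j\<in>UNIV. \<Sum>A | A \<in> {A. card A = k} \<and> j \<notin> A. u t A) = (\<Sum>A\<in>{A. card A = k}. \<Sum>j | j \<in> UNIV \<and> j \<notin> A. u t A)"
    by (rule sum.swap_restrict) auto
  also have "\<dots> = (\<Sum>A\<in>{A. card A = k}. (real CARD('n) - k) * u t A)"
  proof (intro sum.cong refl)
    fix A :: "'n set" assume "A \<in> {A. card A = k}"
    then have "real (card (- A)) = real CARD('n) - k"
      using card_mono[of UNIV A] by (auto simp: Compl_eq_Diff_UNIV card_Diff_subset of_nat_diff)
    then show "(\<Sum>j | j \<in> UNIV \<and> j \<notin> A. u t A) = (real CARD('n) - k) * u t A"
      by (simp add: Compl_eq)
  qed
  finally show ?thesis by (simp add: sum_distrib_left)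
qed

text \<open>Chebyshev's inequality for the weights and the probabilities that \<open>j\<close> is a
  nonadopter at level \<open>k\<close>. At level 0 the weights carry the factor 0, so level 1 is the
  first where strictness can occur.\<close>

lemma flux_le:
  assumes wbar: "wbar = (\<Sum>j\<in>UNIV. w j) / real CARD('n)"
  shows "0 \<le> t \<Longrightarrow> flux k t \<le> (real CARD('n) - k) * (p + wbar * k) * (tail k t - tail (Suc k) t)"
    and "w j < w i \<Longrightarrow> 0 < t \<Longrightarrow>
      flux 1 t < (real CARD('n) - 1) * (p + wbar * 1) * (tail 1 t - tail (Suc 1) t)"
proof -
  let ?b = "\<lambda>k j. \<Sum>A | card A = k \<and> j \<notin> A. u t A"
  have sum_w: "(\<Sum>j\<in>UNIV. w j) = real CARD('n) * wbar"
    by (simp add: wbar)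
  have eq: "(real CARD('n) - k) * (p + wbar * k) * (tail k t - tail (Suc k) t) =
     p * (real CARD('n) - k) * (\<Sum>A | card A = k. u t A) + k * (wbar * (\<Sum>j\<in>UNIV. ?b k j))" for k
    unfolding tail_diff sum_level_without by (simp add: algebra_simps)
  show "flux k t \<le> (real CARD('n) - k) * (p + wbar * k) * (tail k t - tail (Suc k) t)" if "0 \<le> t"
  proof -
    have "real CARD('n) * (\<Sum>j\<in>UNIV. w j * ?b k j) \<le> (\<Sum>j\<in>UNIV. w j) * (\<Sum>j\<in>UNIV. ?b k j)"
      using that by (intro chebyshev_sum_antitone(1) level_without_antimono(1))
    then have "(\<Sum>j\<in>UNIV. w j * ?b k j) \<le> wbar * (\<Sum>j\<in>UNIV. ?b k j)"
      unfolding sum_w mult.assoc by simp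
    then show ?thesis
      unfolding flux_eq eq by (intro add_left_mono mult_left_mono) auto
  qed
  show "flux 1 t < (real CARD('n) - 1) * (p + wbar * 1) * (tail 1 t - tail (Suc 1) t)" if "w j < w i" "0 < t"
  proof -
    \<comment> \<open>The singleton \<open>{j}\<close> contains \<open>j\<close> but not
      \<open>i\<close>, which supplies the strict exchange.\<close>
    have "?b 1 i < ?b 1 j"
      using that by (intro level_without_antimono(2)[where A="{j}"]) auto
    then have "real CARD('n) * (\<Sum>j\<in>UNIV. w j * ?b 1 j) < (\<Sum>j\<in>UNIV. w j) * (\<Sum>j\<in>UNIV. ?b 1 j)"
      using that by (intro chebyshev_sum_antitone(2)[of w _ j i] level_without_antimono(1)) auto
    then have "(\<Sum>j\<in>UNIV. w j * ?b 1 j) < wbar * (\<Sum>j\<in>UNIV. ?b 1 j)"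
      unfolding sum_w mult.assoc by simp
    then show ?thesis
      using eq[of 1] unfolding flux_eq by simp
  qed
qed

text \<open>With equal weights averaging loses nothing, so the bound of \<open>flux_le\<close> is
  attained and the tails satisfy a closed system.\<close>

lemma flux_const:
  assumes "\<And>j. w j = c"
  shows "flux k t = (real CARD('n) - k) * (p + c * k) * (tail k t - tail (Suc k) t)"
  unfolding flux_eq tail_diff assms sum_distrib_left[symmetric] sum_level_without
  by (simp add: algebra_simps)

end

section \<open>Comparison of the two networks\<close>

lemma mean_field_law_mean_card_less:
  fixes w :: "'n::finite \<Rightarrow> real" and v :: "real \<Rightarrow> 'n set \<Rightarrow> real"
  assumes "mean_field_law p w u" "mean_field_law p (\<lambda>_. wbar) v"
    and wbar: "wbar = (\<Sum>j\<in>UNIV. w j) / real CARD('n)" and "w j < w i" and "0 < t"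
  shows "(\<Sum>A\<in>UNIV. u t A * card A) < (\<Sum>A\<in>UNIV. v t A * card A)"
proof -
  interpret het: mean_field_law p w u by fact
  interpret hom: mean_field_law p "\<lambda>_. wbar" v by fact
  let ?c = "\<lambda>k :: nat. (real CARD('n) - k) * (p + wbar * k)"
  let ?E = "\<lambda>k s. hom.tail k s - het.tail k s"
  have E_deriv: "(?E (Suc k) has_real_derivative hom.flux k s - het.flux k s) (at s)" if "0 < s" for k s
    using that by (intro DERIV_diff hom.tail_Suc_deriv het.tail_Suc_deriv)
  have E_cont: "continuous_on {0..} (?E k)" for k
    by (intro continuous_intros hom.tail_continuous het.tail_continuous)
  \<comment> \<open>Each tail difference is driven by the preceding one, starting from
    \<open>?E 0 = 0\<close>. The bound on \<open>k\<close> keeps the coefficient \<open>?c k\<close>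
    nonnegative.\<close>
  have E_nonneg: "0 \<le> ?E k s" if "k \<le> CARD('n)" "0 \<le> s" for k s
    using that
  proof (induction k arbitrary: s)
    case 0
    then show ?case by (simp add: hom.tail_0 het.tail_0)
  next
    case (Suc k)
    have "?E (Suc k) 0 \<le> exp (?c k * s) * ?E (Suc k) s"
    proof (rule exp_weighted_increasing(1)[OF E_cont E_deriv])
      fix r :: real assume "0 < r"
      then have "het.flux k r \<le> ?c k * (het.tail k r - het.tail (Suc k) r)"
        by (intro het.flux_le(1)[OF wbar]) simp
      moreover have "hom.flux k r = ?c k * (hom.tail k r - hom.tail (Suc k) r)"
        by (rule hom.flux_const[OF refl])
      moreover have "0 \<le> ?c k * ?E k r"
        using Suc \<open>0 < r\<close> hom.rate_pos[of k] by (intro mult_nonneg_nonneg) auto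
      ultimately show "- ?c k * ?E (Suc k) r \<le> hom.flux k r - het.flux k r"
        by (simp add: right_diff_distrib)
    qed (use Suc in auto)
    then have "0 \<le> exp (?c k * s) * ?E (Suc k) s"
      by (simp add: hom.tail_Suc_init het.tail_Suc_init)
    then show ?case by (simp add: zero_le_mult_iff)
  qed
  \<comment> \<open>Different weights require two nodes; this puts the second tail into the sum for
    the mean.\<close>
  have two: "2 \<le> CARD('n)"
  proof -
    have "card {i, j} \<le> CARD('n)" by (intro card_mono) auto
    then show ?thesis using \<open>w j < w i\<close> by (cases "i = j") auto
  qed
  have "?E (Suc 1) 0 < exp (?c 1 * t) * ?E (Suc 1) t"
  proof (rule exp_weighted_increasing(2)[OF E_cont E_deriv \<open>0 < t\<close>])
    fix r :: real assume "0 < r"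
    then have "het.flux 1 r < ?c 1 * (het.tail 1 r - het.tail (Suc 1) r)"
      using het.flux_le(2)[OF wbar \<open>w j < w i\<close>] by simp
    moreover have "hom.flux 1 r = ?c 1 * (hom.tail 1 r - hom.tail (Suc 1) r)"
      by (rule hom.flux_const[OF refl])
    moreover have "0 \<le> ?c 1 * ?E 1 r"
      using E_nonneg[of 1 r] two \<open>0 < r\<close> hom.rate_pos[of 1] by (intro mult_nonneg_nonneg) auto
    ultimately show "- ?c 1 * ?E (Suc 1) r < hom.flux 1 r - het.flux 1 r"
      by (simp add: right_diff_distrib)
  qed
  then have "0 < exp (?c 1 * t) * ?E (Suc 1) t"
    by (simp only: hom.tail_Suc_init het.tail_Suc_init diff_self)
  then have "het.tail 2 t < hom.tail 2 t"
    by (simp add: zero_less_mult_iff numeral_2_eq_2)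
  moreover have "\<forall>k\<in>{1..CARD('n)}. het.tail k t \<le> hom.tail k t"
    using E_nonneg[of _ t] \<open>0 < t\<close> by auto
  ultimately show ?thesis
    unfolding het.mean_card hom.mean_card
    using two by (intro sum_strict_mono_ex1) (auto intro!: bexI[of _ 2])
qed

section \<open>The discrete Bass model\<close>

text \<open>The diagonal entry is minus the total rate, so applying the generator to
  \<open>g\<close> gives rates times increments, the shape used in \<open>forward\<close>.\<close>

lemma bass_generator_sum:
  fixes g :: "'n::finite set \<Rightarrow> real"
  shows "(\<Sum>B\<in>UNIV. bass_generator p q A B * g B) =
    (\<Sum>j\<in>UNIV - A. adoption_rate p q A j * (g (insert j A) - g A))"
proof -
  have "bass_generator p q A B = (\<Sum>j\<in>UNIV - A. adoption_rate p q A j * (of_bool (B = insert j A) - of_bool (B = A)))" for B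
  proof (cases "B = A")
    case True
    have "A \<noteq> insert j A" if "j \<notin> A" for j using that by blast
    then show ?thesis using True by (simp add: bass_generator_def sum_negf)
  next
    case False
    then show ?thesis
      unfolding bass_generator_def by (simp only: if_False of_bool_def) (intro sum.cong; simp)
  qed
  then have "(\<Sum>B\<in>UNIV. bass_generator p q A B * g B) =
     (\<Sum>B\<in>UNIV. \<Sum>j\<in>UNIV - A. adoption_rate p q A j * (of_bool (B = insert j A) - of_bool (B = A)) * g B)"
    by (simp add: sum_distrib_right)
  also have "\<dots> = (\<Sum>j\<in>UNIV - A. \<Sum>B\<in>UNIV. adoption_rate p q A j * (of_bool (B = insert j A) * g B - of_bool (B = A) * g B))"
    by (subst sum.swap) (simp add: algebra_simps)
  also have "\<dots> = (\<Sum>j\<in>UNIV - A. adoption_rate p q A j * (g (insert j A) - g A))"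
    by (simp add: sum_distrib_left[symmetric] sum_subtractf)
  finally show ?thesis .
qed

lemma adoption_rate_mild:
  fixes w :: "'n::finite \<Rightarrow> real"
  assumes "j \<notin> A"
  shows "adoption_rate (\<lambda>j. p) (\<lambda>i j. w j) A j = p + w j * card A"
proof -
  have "(\<Sum>k\<in>UNIV - {j}. of_bool (k \<in> A)) = real (card A)"
  proof -
    have "(UNIV - {j}) \<inter> A = A" using assms by auto
    then show ?thesis by (simp add: sum_of_bool_eq)
  qed
  then show ?thesis by (simp add: adoption_rate_def sum_distrib_left[symmetric])
qed

text \<open>Passes from the process to its law: as the chain starts almost surely in the empty set,
  its law is that row of the transition function.\<close>

lemma discrete_bass_model_law:
  fixes X :: "real \<Rightarrow> 'w \<Rightarrow> 'n::finite set"
  assumes "0 < p" "\<And>j. 0 \<le> w j" and bass: "discrete_bass_model \<Omega> X (\<lambda>j. p) (\<lambda>i j. w j)"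
  shows "\<exists>u. mean_field_law p w u \<and>
    (\<forall>t\<ge>0. expected_adopter_fraction \<Omega> X t = 1 / real CARD('n) * (\<Sum>A\<in>UNIV. u t A * card A))"
proof -
  let ?Q = "bass_generator (\<lambda>j. p) (\<lambda>i j. w j) :: 'n set \<Rightarrow> 'n set \<Rightarrow> real"
  have chain: "continuous_time_markov_chain \<Omega> X ?Q" and AE0: "AE \<omega> in \<Omega>. X 0 \<omega> = {}"
    using bass by (auto simp: discrete_bass_model_def)
  interpret prob_space \<Omega>
    using chain by (simp add: continuous_time_markov_chain_def)
  have X [measurable]: "X t \<in> \<Omega> \<rightarrow>\<^sub>M count_space UNIV" if "0 \<le> t" for t
    using chain that by (simp add: continuous_time_markov_chain_def)
  obtain P where P: "transition_function P" "has_generator P ?Q"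
    and markov: "\<And>(n::nat) (t::nat \<Rightarrow> real) s (x::nat \<Rightarrow> 'n set) y.
          0 \<le> t 0 \<Longrightarrow> (\<forall>i<n. t i < t (Suc i)) \<Longrightarrow> t n \<le> s \<Longrightarrow>
          \<P>(\<omega> in \<Omega>. \<forall>i\<le>n. X (t i) \<omega> = x i) > 0 \<Longrightarrow>
          \<P>(\<omega> in \<Omega>. X s \<omega> = y \<bar> \<forall>i\<le>n. X (t i) \<omega> = x i) = P (s - t n) (x n) y"
    using chain unfolding continuous_time_markov_chain_def by blast
  define u where "u t A = P t {} A" for t A
  have prob0: "\<P>(\<omega> in \<Omega>. X 0 \<omega> = {}) = 1"
    using AE0 by (subst prob_Collect_eq_1) auto
  have law: "\<P>(\<omega> in \<Omega>. X t \<omega> = A) = u t A" if "0 \<le> t" for t A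
  proof -
    \<comment> \<open>The Markov property with the single observation time 0; the conditioning event
      has probability 1, so conditioning changes nothing.\<close>
    have "\<P>(\<omega> in \<Omega>. X t \<omega> = A \<bar> X 0 \<omega> = {}) = u t A"
      using markov[of "\<lambda>_. 0" 0 t "\<lambda>_. {}" A] that prob0 by (simp add: u_def)
    moreover have "\<P>(\<omega> in \<Omega>. X t \<omega> = A \<and> X 0 \<omega> = {}) = \<P>(\<omega> in \<Omega>. X t \<omega> = A)"
      using AE0 that by (intro finite_measure_eq_AE) auto
    ultimately show ?thesis
      using prob0 by (simp add: cond_prob_def)
  qed
  have "mean_field_law p w u"
  proof
    show "0 \<le> u t A" "(\<Sum>A\<in>UNIV. u t A) = 1" if "0 \<le> t" for t A
      using P(1) that by (auto simp: transition_function_def u_def)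
    show "u 0 A = of_bool (A = {})" for A
      using P(1) by (auto simp: transition_function_def u_def)
    show "continuous_on {0..} (\<lambda>t. u t A)" for A
      unfolding u_def by (rule transition_function_continuous_on[OF P])
    show "((\<lambda>t. \<Sum>A\<in>UNIV. u t A * g A) has_real_derivative
      (\<Sum>A\<in>UNIV. u t A * (\<Sum>j\<in>- A. (p + w j * card A) * (g (insert j A) - g A)))) (at t)"
      if "0 < t" for t and g :: "'n set \<Rightarrow> real"
    proof -
      \<comment> \<open>Swapping sums moves the generator from \<open>g\<close> to the law, where
        Kolmogorov's equation applies to each state.\<close>
      have "(\<Sum>B\<in>UNIV. ?Q A B * g B) = (\<Sum>j\<in>- A. (p + w j * card A) * (g (insert j A) - g A))" for A
        unfolding bass_generator_sum Compl_eq_Diff_UNIV by (intro sum.cong) (auto simp: adoption_rate_mild)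
      then have "(\<Sum>A\<in>UNIV. u t A * (\<Sum>j\<in>- A. (p + w j * card A) * (g (insert j A) - g A))) =
        (\<Sum>A\<in>UNIV. \<Sum>B\<in>UNIV. u t A * (?Q A B * g B))"
        by (simp add: sum_distrib_left[symmetric])
      also have "\<dots> = (\<Sum>B\<in>UNIV. (\<Sum>A\<in>UNIV. u t A * ?Q A B) * g B)"
        by (subst sum.swap) (simp add: sum_distrib_right mult.assoc)
      finally have eq: "(\<Sum>A\<in>UNIV. u t A * (\<Sum>j\<in>- A. (p + w j * card A) * (g (insert j A) - g A))) =
        (\<Sum>B\<in>UNIV. (\<Sum>A\<in>UNIV. u t A * ?Q A B) * g B)" .
      show ?thesis
        unfolding eq unfolding u_def
        by (intro DERIV_sum DERIV_cmult_right kolmogorov_forward[OF P that])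
    qed
  qed (use assms in auto)
  moreover have "expected_adopter_fraction \<Omega> X t = 1 / real CARD('n) * (\<Sum>A\<in>UNIV. u t A * card A)"
    if t: "0 \<le> t" for t
  proof -
    note X[OF t, measurable]
    \<comment> \<open>Decomposing by the value of \<open>X t\<close> turns the expectation into a
      finite sum over the law.\<close>
    have "(\<integral>\<omega>. (\<Sum>j\<in>(UNIV :: 'n set). of_bool (j \<in> X t \<omega>)) \<partial>\<Omega>) =
      (\<integral>\<omega>. (\<Sum>A\<in>UNIV. indicator {\<omega> \<in> space \<Omega>. X t \<omega> = A} \<omega> * real (card A)) \<partial>\<Omega>)"
    proof (rule Bochner_Integration.integral_cong[OF refl])
      fix \<omega> assume "\<omega> \<in> space \<Omega>"
      then have "(\<Sum>A\<in>UNIV. indicator {\<omega> \<in> space \<Omega>. X t \<omega> = A} \<omega> * real (card A)) =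
        (\<Sum>A\<in>UNIV. if A = X t \<omega> then real (card A) else 0)"
        by (intro sum.cong) auto
      then show "(\<Sum>j\<in>UNIV. of_bool (j \<in> X t \<omega>)) =
        (\<Sum>A\<in>UNIV. indicator {\<omega> \<in> space \<Omega>. X t \<omega> = A} \<omega> * real (card A))"
        by (simp add: sum_of_bool_eq)
    qed
    also have "\<dots> = (\<Sum>A\<in>UNIV. u t A * card A)"
    proof -
      have "integrable \<Omega> (\<lambda>\<omega>. indicator {\<omega> \<in> space \<Omega>. X t \<omega> = A} \<omega> * real (card A))" for A
        by (intro integrable_mult_left integrable_real_indicator) (auto simp: emeasure_eq_measure)
      then show ?thesis
        by (subst Bochner_Integration.integral_sum) (auto simp: law[OF t])
    qed
    finally show ?thesis by (simp add: expected_adopter_fraction_def)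
  qed
  ultimately show ?thesis by auto
qed

theorem theorem4:
  fixes p :: real and q :: "'n::finite \<Rightarrow> real" and qbar :: real
    and \<Omega>het :: "'a measure" and Xhet :: "real \<Rightarrow> 'a \<Rightarrow> 'n set"
    and \<Omega>hom :: "'b measure" and Xhom :: "real \<Rightarrow> 'b \<Rightarrow> 'n set"
  assumes "CARD('n) \<ge> 2"
    and "p > 0"
    and "\<And>i. q i > 0"
    and "\<exists>i j. q i \<noteq> q j"
    and "qbar = 1 / real CARD('n) * (\<Sum>i\<in>UNIV. q i)"
    and "discrete_bass_model \<Omega>het Xhet (\<lambda>j. p) (\<lambda>i j. q j / (real CARD('n) - 1))"
    and "discrete_bass_model \<Omega>hom Xhom (\<lambda>j. p) (\<lambda>i j. qbar / (real CARD('n) - 1))"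
  shows "\<forall>t>0. expected_adopter_fraction \<Omega>het Xhet t < expected_adopter_fraction \<Omega>hom Xhom t"
proof (intro allI impI)
  fix t :: real assume "0 < t"
  let ?m = "real CARD('n) - 1"
  have m: "0 < ?m" using assms(1) by simp
  have q_nonneg: "0 \<le> q j / ?m" for j
    using assms(3)[of j] m by simp
  have qbar_nonneg: "0 \<le> qbar / ?m"
    using assms(3) m by (simp add: assms(5) sum_nonneg less_imp_le)
  \<comment> \<open>From here on only the laws matter, so the two processes may live on different
    probability spaces.\<close>
  obtain u where u: "mean_field_law p (\<lambda>j. q j / ?m) u"
    "\<forall>t\<ge>0. expected_adopter_fraction \<Omega>het Xhet t = 1 / real CARD('n) * (\<Sum>A\<in>UNIV. u t A * card A)"
    using discrete_bass_model_law[OF assms(2) q_nonneg assms(6)] by (elim exE conjE)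
  obtain v where v: "mean_field_law p (\<lambda>j :: 'n. qbar / ?m) v"
    "\<forall>t\<ge>0. expected_adopter_fraction \<Omega>hom Xhom t = 1 / real CARD('n) * (\<Sum>A\<in>UNIV. v t A * card A)"
    using discrete_bass_model_law[OF assms(2) qbar_nonneg assms(7)] by (elim exE conjE)
  obtain i j where "q j < q i"
    using assms(4) by (meson linorder_neqE)
  then have "q j / ?m < q i / ?m"
    using m by (simp add: divide_strict_right_mono)
  moreover have "qbar / ?m = (\<Sum>j\<in>UNIV. q j / ?m) / real CARD('n)"
    by (simp add: assms(5) sum_divide_distrib[symmetric])
  ultimately have "(\<Sum>A\<in>UNIV. u t A * card A) < (\<Sum>A\<in>UNIV. v t A * card A)"
    using mean_field_law_mean_card_less[OF u(1) v(1)] \<open>0 < t\<close> by blast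
  then show "expected_adopter_fraction \<Omega>het Xhet t < expected_adopter_fraction \<Omega>hom Xhom t"
    using \<open>0 < t\<close> by (simp add: u(2) v(2) divide_strict_right_mono)
qed

end
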